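(* Let $H$ be an infinite-dimensional separable complex Hilbert space. Then $\mathcal{M}_r(H)$ is dense in $\mathcal{B}(H)$ with respect to the operator norm.
   Context: $\mathcal{B}(H)$ denotes the bounded linear operators on $H$. For a nonzero Hilbert space $M$ and $A\in\mathcal{B}(M)$, the minimum modulus is $m(A)=\inf\{\|Ax\|: x\in M,\ \|x\|=1\}$; $A$ is minimum attaining if there is a unit vector $x_0\in M$ with $\|Ax_0\|=m(A)$. A closed subspace $M\subseteq H$ reduces $T\in\mathcal{B}(H)$ if $T(M)\subseteq M$ and $T^*(M)\subseteq M$. $\mathcal{M}_r(H)$ is the set of all $T\in\mathcal{B}(H)$ such that for every nonzero closed subspace $M$ reducing $T$, the restriction $T|_M:M\to M$ is minimum attaining. *)

theory Defs
  imports "HOL-Analysis.Analysis"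
begin

class complex_vector = real_vector +
  fixes scaleC :: "complex \<Rightarrow> 'a \<Rightarrow> 'a"  (infixr \<open>*\<^sub>C\<close> 75)
  assumes scaleC_add_right: "a *\<^sub>C (x + y) = a *\<^sub>C x + a *\<^sub>C y"
    and scaleC_add_left: "(a + b) *\<^sub>C x = a *\<^sub>C x + b *\<^sub>C x"
    and scaleC_scaleC: "a *\<^sub>C (b *\<^sub>C x) = (a * b) *\<^sub>C x"
    and scaleC_one: "1 *\<^sub>C x = x"
    and scaleR_scaleC: "scaleR r x = complex_of_real r *\<^sub>C x"

global_interpretation complex_vector: vector_space "scaleC :: complex \<Rightarrow> 'a \<Rightarrow> 'a::complex_vector"
  by unfold_locales (auto simp: scaleC_add_right scaleC_add_left scaleC_scaleC scaleC_one)

text \<open>The complex inner product is linear in its first argument and conjugate-linear in its second.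
  A complex inner product space is also a real one for the real part of the product, with the same norm:
  positive definiteness and \<open>norm x = sqrt (Re (cinner x x))\<close> are inherited from \<open>real_inner\<close>,
  and \<open>cinner x x\<close> is real by \<open>cinner_commute\<close>.\<close>

class complex_inner = complex_vector + real_inner +
  fixes cinner :: "'a \<Rightarrow> 'a \<Rightarrow> complex"
  assumes cinner_commute: "cinner x y = cnj (cinner y x)"
    and cinner_add_left: "cinner (x + y) z = cinner x z + cinner y z"
    and cinner_scaleC_left: "cinner (c *\<^sub>C x) y = c * cinner x y"
    and inner_eq_Re_cinner: "inner x y = Re (cinner x y)"

class complex_hilbert = complex_inner + complete_space

definition infinite_dimensional :: "'a::complex_vector itself \<Rightarrow> bool" where
  "infinite_dimensional _ \<longleftrightarrow> (\<nexists>B::'a set. finite B \<and> complex_vector.span B = UNIV)"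

text \<open>The type \<open>'a \<Rightarrow>\<^sub>L 'a\<close> consists of the bounded real-linear maps, with the operator norm;
  the bounded complex-linear operators are a subset of it.\<close>

definition bounded_ops :: "('a::complex_inner \<Rightarrow>\<^sub>L 'a) set" where
  "bounded_ops = {T. \<forall>c x. blinfun_apply T (c *\<^sub>C x) = c *\<^sub>C blinfun_apply T x}"

definition is_cadjoint :: "('a::complex_inner \<Rightarrow>\<^sub>L 'a) \<Rightarrow> ('a \<Rightarrow>\<^sub>L 'a) \<Rightarrow> bool" where
  "is_cadjoint T S \<longleftrightarrow> S \<in> bounded_ops \<and>
    (\<forall>x y. cinner (blinfun_apply T x) y = cinner x (blinfun_apply S y))"

text \<open>The description is well defined for \<open>T \<in> bounded_ops\<close>, see \<open>ex1_is_cadjoint\<close> below.\<close>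

definition cadjoint :: "('a::complex_hilbert \<Rightarrow>\<^sub>L 'a) \<Rightarrow> ('a \<Rightarrow>\<^sub>L 'a)" where
  "cadjoint T = (THE S. is_cadjoint T S)"

lemma riesz_real:
  fixes f :: "'a::{real_inner, complete_space} \<Rightarrow> real"
  assumes f: "bounded_linear f"
  shows "\<exists>z. \<forall>x. f x = inner x z"
proof -
  interpret f: bounded_linear f by (rule f)
  define g where "g x = inner x x / 2 - f x" for x
  obtain K where K: "\<And>x. norm (f x) \<le> norm x * K" using f.bounded by blast
  have lower: "g x \<ge> - (K\<^sup>2 / 2)" for x
  proof -
    have "f x \<le> norm x * K" using K[of x] by simp
    moreover have "0 \<le> (norm x - K)\<^sup>2" by simp
    ultimately show ?thesis
      by (simp add: g_def power2_diff dot_square_norm)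
  qed
  define m where "m = Inf (range g)"
  have bdd: "bdd_below (range g)" by (rule bdd_belowI2) (rule lower)
  have m_le: "m \<le> g x" for x unfolding m_def by (rule cINF_lower[OF bdd]) simp
  have "\<exists>x. g x < m + 1 / Suc n" for n
    using cINF_less_iff[OF UNIV_not_empty bdd, of "m + 1 / Suc n"] by (auto simp: m_def)
  then obtain X where X: "\<And>n. g (X n) < m + 1 / Suc n" by metis
  have par: "(norm (x - y))\<^sup>2 = 4 * (g x + g y) - 8 * g ((1/2) *\<^sub>R (x + y))" for x y
    by (simp add: g_def power2_norm_eq_inner f.scale f.add inner_simps inner_commute[of y x] field_simps)
  have ineq: "(norm (x - y))\<^sup>2 \<le> 4 * ((g x - m) + (g y - m))" for x y
    using par[of x y] m_le[of "(1/2) *\<^sub>R (x + y)"] by simp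
  have "Cauchy X"
  proof (rule metric_CauchyI)
    fix e :: real assume e: "e > 0"
    then obtain N where N: "1 / Suc N < e\<^sup>2 / 8"
      by (metis nat_approx_posE zero_less_power divide_pos_pos zero_less_numeral)
    have "dist (X a) (X b) < e" if "a \<ge> N" "b \<ge> N" for a b
    proof -
      have "1 / real (Suc a) \<le> 1 / Suc N" "1 / real (Suc b) \<le> 1 / Suc N"
        using that by (auto simp: field_simps)
      then have "(norm (X a - X b))\<^sup>2 < e\<^sup>2"
        using ineq[of "X a" "X b"] X[of a] X[of b] N by simp
      then show ?thesis using e by (simp add: dist_norm power2_less_imp_less)
    qed
    then show "\<exists>N. \<forall>a\<ge>N. \<forall>b\<ge>N. dist (X a) (X b) < e" by blast
  qed
  then obtain z where z: "X \<longlonglongrightarrow> z" by (auto simp: Cauchy_convergent_iff convergent_def)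
  have "(\<lambda>n. g (X n)) \<longlonglongrightarrow> g z"
    unfolding g_def by (intro tendsto_intros z f.tendsto) simp
  moreover have "(\<lambda>n. m + 1 / Suc n) \<longlonglongrightarrow> m + 0"
    by (intro tendsto_intros LIMSEQ_Suc lim_1_over_n)
  ultimately have gz: "g z \<le> m"
    using LIMSEQ_le[of "\<lambda>n. g (X n)" "g z" "\<lambda>n. m + 1 / Suc n" "m + 0"] X by (auto intro: less_imp_le)
  have "f h = inner h z" for h
  proof -
    let ?d = "inner h z - f h"
    have q: "0 \<le> t * ?d + t\<^sup>2 * (inner h h / 2)" for t
      using m_le[of "z + t *\<^sub>R h"] gz
      by (simp add: g_def f.add f.scale inner_simps inner_commute[of z h] power2_eq_square field_simps)
    show ?thesis
    proof (cases "h = 0")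
      case True then show ?thesis by (simp add: f.zero)
    next
      case False
      then have "inner h h > 0" by simp
      moreover have "- d / H * d + (- d / H)\<^sup>2 * (H / 2) = - (d\<^sup>2 / (2 * H))" if "H > 0" for d H :: real
        using that by (simp add: power2_eq_square field_simps)
      ultimately have "0 \<le> - (?d\<^sup>2 / (2 * inner h h))"
        using q[of "- ?d / inner h h"] by metis
      with \<open>inner h h > 0\<close> have "?d\<^sup>2 \<le> 0"
        by (simp add: divide_le_0_iff del: inner_gt_zero_iff)
      then show ?thesis by simp
    qed
  qed
  then show ?thesis by blast
qed

lemma cinner_eqI:
  fixes y z :: "'a::complex_inner"
  assumes "\<And>x. cinner x y = cinner x z"
  shows "y = z"
proof -
  have "inner x (y - z) = 0" for x
    unfolding inner_diff_right unfolding inner_eq_Re_cinner using assms[of x] by simp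
  then show ?thesis using inner_eq_zero_iff[of "y - z"] by simp
qed

lemma cinner_add_right: "cinner x (y + z) = cinner x y + cinner x (z :: 'a::complex_inner)"
  by (metis cinner_add_left cinner_commute complex_cnj_add)

lemma cinner_scaleC_right: "cinner x (c *\<^sub>C y) = cnj c * cinner x (y :: 'a::complex_inner)"
  by (metis cinner_scaleC_left cinner_commute complex_cnj_mult)

lemma Im_cinner: "Im (cinner x y) = inner (- \<i> *\<^sub>C x) (y :: 'a::complex_inner)"
  unfolding inner_eq_Re_cinner by (subst cinner_scaleC_left) simp

lemma ex1_is_cadjoint:
  fixes T :: "'a::complex_hilbert \<Rightarrow>\<^sub>L 'a"
  assumes T: "T \<in> bounded_ops"
  shows "\<exists>!S. is_cadjoint T S"
proof -
  have TC: "T (c *\<^sub>C x) = c *\<^sub>C T x" for c x using T by (simp add: bounded_ops_def)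
  have "\<exists>z. \<forall>x. inner (T x) y = inner x z" for y
    by (rule riesz_real) (intro bounded_linear_intros)
  then obtain s where s: "\<And>x y. inner (T x) y = inner x (s y)" by metis
  have cs: "cinner (T x) y = cinner x (s y)" for x y
  proof (rule complex_eqI)
    show "Re (cinner (T x) y) = Re (cinner x (s y))" using s by (simp add: inner_eq_Re_cinner)
    show "Im (cinner (T x) y) = Im (cinner x (s y))"
      by (simp only: Im_cinner TC[symmetric] s)
  qed
  have sadd: "s (x + y) = s x + s y" for x y
    by (rule cinner_eqI) (simp only: cs[symmetric] cinner_add_right)
  have sC: "s (c *\<^sub>C x) = c *\<^sub>C s x" for c x
    by (rule cinner_eqI) (simp only: cs[symmetric] cinner_scaleC_right)
  have bl: "bounded_linear s"
  proof (rule bounded_linear_intro[where K = "norm T"])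
    show "s (x + y) = s x + s y" for x y by (rule sadd)
    show "s (r *\<^sub>R x) = r *\<^sub>R s x" for r x by (simp add: scaleR_scaleC sC)
    show "norm (s x) \<le> norm x * norm T" for x
    proof (cases "s x = 0")
      case False
      have "norm (s x) * norm (s x) = inner (T (s x)) x"
        by (simp add: s flip: power2_norm_eq_inner power2_eq_square)
      also have "\<dots> \<le> norm (T (s x)) * norm x" by (rule norm_cauchy_schwarz)
      also have "\<dots> \<le> (norm T * norm (s x)) * norm x"
        by (intro mult_right_mono norm_blinfun) simp
      finally have "norm (s x) * norm (s x) \<le> norm (s x) * (norm x * norm T)"
        by (simp add: algebra_simps)
      with False show ?thesis by simp
    qed simp
  qed
  show ?thesis
  proof (rule ex1I)
    show "is_cadjoint T (Blinfun s)"
      by (simp add: is_cadjoint_def bounded_ops_def bounded_linear_Blinfun_apply[OF bl] sC cs)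
    show "S = Blinfun s" if "is_cadjoint T S" for S
    proof (rule blinfun_eqI)
      show "S y = Blinfun s y" for y
        unfolding bounded_linear_Blinfun_apply[OF bl]
        by (rule cinner_eqI) (use that cs in \<open>simp add: is_cadjoint_def\<close>)
    qed
  qed
qed

lemma is_cadjoint_cadjoint: "T \<in> bounded_ops \<Longrightarrow> is_cadjoint T (cadjoint T)"
  unfolding cadjoint_def by (rule theI') (rule ex1_is_cadjoint)

text \<open>A subspace \<open>M\<close> is a set of vectors, so the operator \<open>A\<close> on \<open>M\<close> is given by a map on the
  whole type of which only the values on \<open>M\<close> matter.  The infimum is meaningful only for
  \<open>M \<noteq> {0}\<close>.\<close>

definition min_modulus :: "'a::complex_inner set \<Rightarrow> ('a \<Rightarrow> 'a) \<Rightarrow> real" where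
  "min_modulus M A = Inf {norm (A x) |x. x \<in> M \<and> norm x = 1}"

definition minimum_attaining :: "'a::complex_inner set \<Rightarrow> ('a \<Rightarrow> 'a) \<Rightarrow> bool" where
  "minimum_attaining M A \<longleftrightarrow> (\<exists>x\<in>M. norm x = 1 \<and> norm (A x) = min_modulus M A)"

definition closed_csubspace :: "'a::complex_inner set \<Rightarrow> bool" where
  "closed_csubspace M \<longleftrightarrow> complex_vector.subspace M \<and> closed M"

definition reduces :: "'a::complex_hilbert set \<Rightarrow> ('a \<Rightarrow>\<^sub>L 'a) \<Rightarrow> bool" where
  "reduces M T \<longleftrightarrow> blinfun_apply T ` M \<subseteq> M \<and> blinfun_apply (cadjoint T) ` M \<subseteq> M"

definition min_attaining_reducing :: "('a::complex_hilbert \<Rightarrow>\<^sub>L 'a) set" where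
  "min_attaining_reducing =
    {T \<in> bounded_ops. \<forall>M. closed_csubspace M \<and> M \<noteq> {0} \<and> reduces M T
       \<longrightarrow> minimum_attaining M (blinfun_apply T)}"

end

theory Submission
  imports Defs
begin

text \<open>If \<open>S\<^sup>* S\<close> has finite spectrum, then \<open>S\<close> is minimum attaining on every nonzero reducing
  subspace \<open>M\<close>: \<open>M\<close> is the sum of its intersections with the eigenspaces, and the minimum is attained
  at the smallest eigenvalue that occurs in \<open>M\<close>.  To approximate \<open>T\<close> by such an \<open>S\<close>, let \<open>A = |T|\<close>,
  let \<open>D\<close> be a combination of spectral projections of \<open>A\<close> close to \<open>A\<close>, and let \<open>E\<close> be the spectral
  projection of \<open>A\<close> for a small threshold \<open>\<delta>\<close>.  The inverse \<open>R\<close> of \<open>max(A, \<delta>)\<close> satisfies \<open>A R E = E\<close>.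
  Put \<open>S = T R E D\<close>; then \<open>S\<^sup>* S = D E D\<close> and \<open>\<parallel>T - S\<parallel> = \<parallel>A - E D\<parallel>\<close> is small.  Only square roots and
  projections onto closed subspaces are needed, so no spectral theorem enters.  All of this takes place in
  the underlying real Hilbert space; complex linearity is recovered because the operators other than \<open>T\<close>
  commute with everything that, like multiplication by a scalar, has an adjoint and commutes with \<open>T\<^sup>* T\<close>.\<close>

section \<open>Adjoint pairs, commutation and bicommutants\<close>

text \<open>A relation in the real inner product, so that it covers \<open>cadjoint\<close> and
  multiplication by a complex scalar alike.\<close>

definition adjoint_pair :: "('a::real_inner \<Rightarrow>\<^sub>L 'a) \<Rightarrow> ('a \<Rightarrow>\<^sub>L 'a) \<Rightarrow> bool" where
  "adjoint_pair V W \<longleftrightarrow> (\<forall>x y. inner (V x) y = inner x (W y))"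

abbreviation selfadjoint :: "('a::real_inner \<Rightarrow>\<^sub>L 'a) \<Rightarrow> bool" where
  "selfadjoint A \<equiv> adjoint_pair A A"

definition commutes :: "('a::real_normed_vector \<Rightarrow>\<^sub>L 'a) \<Rightarrow> ('a \<Rightarrow>\<^sub>L 'a) \<Rightarrow> bool" where
  "commutes V W \<longleftrightarrow> (\<forall>x. V (W x) = W (V x))"

text \<open>The double commutant of \<open>A\<close>, tested against operators with an adjoint,
  which for selfadjoint \<open>A\<close> then commutes with \<open>A\<close> as well. It stands in
  for functional calculus: square roots, spectral projections and inverses of \<open>A\<close> lie
  in it.\<close>

definition in_bicommutant :: "('a::real_inner \<Rightarrow>\<^sub>L 'a) \<Rightarrow> ('a \<Rightarrow>\<^sub>L 'a) \<Rightarrow> bool" where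
  "in_bicommutant A B \<longleftrightarrow> (\<forall>V W. adjoint_pair V W \<and> commutes V A \<longrightarrow> commutes V B)"

lemma adjoint_pairD: "adjoint_pair V W \<Longrightarrow> inner (V x) y = inner x (W y)"
  by (simp add: adjoint_pair_def)

lemma commutesD: "commutes V W \<Longrightarrow> V (W x) = W (V x)"
  by (simp add: commutes_def)

lemma commutes_sym: "commutes V W \<Longrightarrow> commutes W V"
  by (simp add: commutes_def)

lemma commutes_self: "commutes V V"
  by (simp add: commutes_def)

lemma in_bicommutantD:
  "in_bicommutant A B \<Longrightarrow> adjoint_pair V W \<Longrightarrow> commutes V A \<Longrightarrow> commutes V B"
  by (auto simp: in_bicommutant_def)

lemma inner_right_extensionality:
  fixes x z :: "'a::real_inner"
  shows "(\<And>y. inner x y = inner z y) \<Longrightarrow> x = z"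
  using vector_eq_rdot[of x z] by simp

section \<open>Square roots of positive operators\<close>

text \<open>Polarization: with \<open>y\<close> the multiple of \<open>P x\<close> that has the norm
  of \<open>x\<close>, \<open>norm x * norm (P x)\<close> is a quarter of a difference of two values
  of the form, which the parallelogram law bounds.\<close>

lemma norm_le_quadratic_form:
  fixes P :: "'a::real_inner \<Rightarrow>\<^sub>L 'a"
  assumes P: "selfadjoint P" and c: "\<And>x. \<bar>inner (P x) x\<bar> \<le> c * (norm x)\<^sup>2"
    and "0 \<le> c"
  shows "norm P \<le> c"
proof (rule norm_blinfun_bound[OF \<open>0 \<le> c\<close>])
  fix x
  show "norm (P x) \<le> c * norm x"
  proof (cases "P x = 0 \<or> x = 0")
    case True
    then show ?thesis using \<open>0 \<le> c\<close> by auto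
  next
    case False
    define y where "y = (norm x / norm (P x)) *\<^sub>R P x"
    have ny: "norm y = norm x" using False by (simp add: y_def)
    have ixy: "inner (P x) y = norm x * norm (P x)"
      using False by (simp add: y_def dot_square_norm power2_eq_square)
    have "4 * inner (P x) y = inner (P (x + y)) (x + y) - inner (P (x - y)) (x - y)"
      using adjoint_pairD[OF P, of y x]
      by (simp add: blinfun.bilinear_simps inner_simps inner_commute)
    also have "\<dots> \<le> c * ((norm (x + y))\<^sup>2 + (norm (x - y))\<^sup>2)"
      using c[of "x + y"] c[of "x - y"] by (simp add: algebra_simps)
    also have "(norm (x + y))\<^sup>2 + (norm (x - y))\<^sup>2 = 4 * (norm x)\<^sup>2"
      using arg_cong[OF ny, of power2] by (simp add: power2_norm_eq_inner inner_simps)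
    finally have "norm x * norm (P x) \<le> norm x * (c * norm x)"
      by (simp add: ixy power2_eq_square mult_ac)
    then show ?thesis using False by simp
  qed
qed

text \<open>The equation says \<open>(1 - Y)\<^sup>2 = 1 - X\<close>.  The iteration \<open>Y \<mapsto> (X + Y\<^sup>2) / 2\<close> is dominated by
  the same iteration for the number 1, which increases and stays below 1; this gives convergence in norm
  although the map need not be a contraction.\<close>

lemma sqrt_one_minus_fixpoint:
  fixes X :: "'a::{real_inner, banach} \<Rightarrow>\<^sub>L 'a"
  assumes X: "selfadjoint X" and nX: "norm X \<le> 1"
  obtains Y where "selfadjoint Y" "norm Y \<le> 1" "in_bicommutant X Y"
    "\<And>x. 2 *\<^sub>R Y x = X x + Y (Y x)"
proof -
  define Y where "Y n = ((\<lambda>Y. (1/2) *\<^sub>R (X + (Y o\<^sub>L Y))) ^^ n) 0" for n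
  define s :: "nat \<Rightarrow> real" where "s n = ((\<lambda>t. (1 + t\<^sup>2) / 2) ^^ n) 0" for n
  have Y0: "Y 0 = 0" and YS: "Y (Suc n) = (1/2) *\<^sub>R (X + (Y n o\<^sub>L Y n))" for n
    by (simp_all add: Y_def)
  have s0: "s 0 = 0" and sS: "s (Suc n) = (1 + (s n)\<^sup>2) / 2" for n
    by (simp_all add: s_def)
  have s01: "0 \<le> s n \<and> s n \<le> 1" for n
    by (induction n) (auto simp: s0 sS power_le_one)
  have nY: "norm (Y n) \<le> s n" for n
  proof (induction n)
    case (Suc n)
    have "norm (Y n o\<^sub>L Y n) \<le> norm (Y n) * norm (Y n)" by (rule norm_blinfun_compose)
    also have "\<dots> \<le> s n * s n" using Suc s01[of n] by (intro mult_mono) auto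
    finally have "norm (X + (Y n o\<^sub>L Y n)) \<le> 1 + (s n)\<^sup>2"
      using nX norm_triangle_ineq[of X "Y n o\<^sub>L Y n"] by (simp add: power2_eq_square)
    then show ?case by (simp add: YS sS)
  qed (simp add: Y0 s0)
  \<comment> \<open>Each iterate is a polynomial in \<open>X\<close>, so it commutes with whatever
    commutes with \<open>X\<close>, in particular with the other iterates.\<close>
  have comm: "commutes W X \<Longrightarrow> commutes W (Y n)" for W n
    by (induction n) (auto simp: commutes_def Y0 YS blinfun.bilinear_simps)
  have commY: "commutes (Y m) (Y n)" for m n
    by (rule comm[OF commutes_sym[OF comm[OF commutes_self]]])
  have saY: "selfadjoint (Y n)" for n
    using X by (induction n) (auto simp: adjoint_pair_def Y0 YS blinfun.bilinear_simps inner_simps)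
  have step: "norm (Y (Suc n) - Y n) \<le> s (Suc n) - s n" for n
  proof (induction n)
    case 0
    show ?case using nX by (simp add: Y0 YS s0 sS)
  next
    case (Suc n)
    \<comment> \<open>A difference of two squares, factored because consecutive iterates commute;
      each factor is bounded by its counterpart for \<open>s\<close>.\<close>
    have "Y (Suc (Suc n)) - Y (Suc n) = (1/2) *\<^sub>R ((Y (Suc n) + Y n) o\<^sub>L (Y (Suc n) - Y n))"
      unfolding YS[of "Suc n"] by (subst YS[of n, THEN arg_cong, where f = "\<lambda>Z. _ - Z"], rule blinfun_eqI)
        (use commutesD[OF commY[of "Suc n" n]] in \<open>simp add: blinfun.bilinear_simps algebra_simps\<close>)
    also have "norm \<dots> \<le> (1/2) * (norm (Y (Suc n) + Y n) * norm (Y (Suc n) - Y n))"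
      using norm_blinfun_compose by simp
    also have "\<dots> \<le> (1/2) * ((s (Suc n) + s n) * (s (Suc n) - s n))"
      using Suc nY[of n] nY[of "Suc n"] s01[of n] s01[of "Suc n"]
        norm_triangle_ineq[of "Y (Suc n)" "Y n"]
      by (intro mult_left_mono mult_mono) auto
    also have "\<dots> = s (Suc (Suc n)) - s (Suc n)"
      unfolding sS[of "Suc n"] by (subst (4) sS) (simp add: power2_eq_square field_simps)
    finally show ?case .
  qed
  have diff: "norm (Y (n + k) - Y n) \<le> s (n + k) - s n" for n k
  proof (induction k)
    case (Suc k)
    have "norm (Y (n + Suc k) - Y n) \<le> norm (Y (Suc (n + k)) - Y (n + k)) + norm (Y (n + k) - Y n)"
      using norm_triangle_ineq[of "Y (Suc (n + k)) - Y (n + k)" "Y (n + k) - Y n"] by simp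
    then show ?case using Suc step[of "n + k"] by simp
  qed simp
  \<comment> \<open>\<open>s\<close> increases and is bounded, hence Cauchy, and \<open>diff\<close>
    carries this over to \<open>Y\<close>.\<close>
  have "incseq s"
  proof (rule incseq_SucI)
    show "s n \<le> s (Suc n)" for n using order_trans[OF norm_ge_zero step[of n]] by simp
  qed
  moreover have "Bseq s" by (rule BseqI'[of _ 1]) (use s01 in auto)
  ultimately have "Cauchy s" by (simp add: Bseq_monoseq_convergent convergent_Cauchy incseq_def monoseq_def)
  have "Cauchy Y"
  proof (rule metric_CauchyI)
    fix e :: real assume "e > 0"
    then obtain N where N: "\<And>m n. m \<ge> N \<Longrightarrow> n \<ge> N \<Longrightarrow> dist (s m) (s n) < e"
      using \<open>Cauchy s\<close> unfolding Cauchy_def by blast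
    have le: "dist (Y m) (Y n) < e" if "m \<ge> n" "n \<ge> N" for m n
      using diff[of n "m - n"] N[of m n] that by (simp add: dist_norm)
    have "dist (Y m) (Y n) < e" if "m \<ge> N" "n \<ge> N" for m n
      using le[of m n] le[of n m] that by (cases "m \<ge> n") (auto simp: dist_commute)
    then show "\<exists>N. \<forall>m\<ge>N. \<forall>n\<ge>N. dist (Y m) (Y n) < e" by blast
  qed
  then obtain L where L: "Y \<longlonglongrightarrow> L" by (auto simp: Cauchy_convergent_iff convergent_def)
  have Lx: "(\<lambda>n. Y n x) \<longlonglongrightarrow> L x" for x by (intro tendsto_intros L)
  show thesis
  proof
    show "selfadjoint L"
      unfolding adjoint_pair_def
    proof (intro allI)
      fix x y
      have "(\<lambda>n. inner (Y n x) y) \<longlonglongrightarrow> inner (L x) y" by (intro tendsto_intros Lx)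
      moreover have "(\<lambda>n. inner (Y n x) y) \<longlonglongrightarrow> inner x (L y)"
        unfolding adjoint_pairD[OF saY] by (intro tendsto_intros Lx)
      ultimately show "inner (L x) y = inner x (L y)" by (rule LIMSEQ_unique)
    qed
    show "norm L \<le> 1"
      by (rule LIMSEQ_le_const2[OF tendsto_norm[OF L]]) (use nY s01 order_trans in blast)
    show "in_bicommutant X L"
      unfolding in_bicommutant_def commutes_def
    proof (intro allI impI)
      fix V W x assume V: "adjoint_pair V W \<and> (\<forall>x. V (X x) = X (V x))"
      have "(\<lambda>n. V (Y n x)) \<longlonglongrightarrow> V (L x)" by (intro tendsto_intros Lx)
      moreover have "V (Y n x) = Y n (V x)" for n
        using V by (intro commutesD comm) (simp add: commutes_def)
      ultimately show "V (L x) = L (V x)" using LIMSEQ_unique[OF _ Lx[of "V x"]] by simp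
    qed
    show "2 *\<^sub>R L x = X x + L (L x)" for x
    proof -
      have "(\<lambda>n. 2 *\<^sub>R Y (Suc n) x) \<longlonglongrightarrow> 2 *\<^sub>R L x"
        by (intro tendsto_intros LIMSEQ_Suc L)
      moreover have "2 *\<^sub>R Y (Suc n) x = X x + Y n (Y n x)" for n
        by (simp add: YS blinfun.bilinear_simps)
      moreover have "(\<lambda>n. X x + Y n (Y n x)) \<longlonglongrightarrow> X x + L (L x)"
        by (intro tendsto_intros L Lx)
      ultimately show ?thesis using LIMSEQ_unique by auto
    qed
  qed
qed

text \<open>Rescaling reduces this to the fixpoint: with \<open>X = 1 - P / c\<close> the equation
  for \<open>Y\<close> reads \<open>(1 - Y)^2 = P / c\<close>, so \<open>R = sqrt c (1 - Y)\<close>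
  is a root. It is positive because \<open>norm Y \<le> 1\<close>.\<close>

lemma positive_sqrt:
  fixes P :: "'a::{real_inner, banach} \<Rightarrow>\<^sub>L 'a"
  assumes P: "selfadjoint P" and pos: "\<And>x. 0 \<le> inner (P x) x"
  obtains R where "selfadjoint R" "\<And>x. 0 \<le> inner (R x) x" "\<And>x. R (R x) = P x"
    "in_bicommutant P R"
proof -
  \<comment> \<open>The added 1 keeps \<open>c\<close> positive even for \<open>P = 0\<close>;
    \<open>0 \<le> P \<le> c\<close> puts the form of \<open>X\<close> between 0 and 1 on unit
    vectors.\<close>
  define c where "c = norm P + 1"
  have c: "c > 0" by (simp add: c_def add_nonneg_pos)
  define X where "X = id_blinfun - (1 / c) *\<^sub>R P"
  have Xx: "X x = x - (1 / c) *\<^sub>R P x" for x by (simp add: X_def blinfun.bilinear_simps)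
  have saX: "selfadjoint X" using P by (simp add: adjoint_pair_def Xx inner_simps)
  have nX: "norm X \<le> 1"
  proof (rule norm_le_quadratic_form[OF saX])
    fix x
    have "inner (P x) x \<le> norm (P x) * norm x" by (rule norm_cauchy_schwarz)
    also have "\<dots> \<le> (norm P * norm x) * norm x" by (intro mult_right_mono norm_blinfun) simp
    also have "\<dots> \<le> c * (norm x)\<^sup>2" by (simp add: c_def power2_eq_square algebra_simps)
    finally have "inner (P x) x / c \<le> (norm x)\<^sup>2" using c by (simp add: field_simps)
    moreover have "0 \<le> inner (P x) x / c" using pos c by simp
    ultimately show "\<bar>inner (X x) x\<bar> \<le> 1 * (norm x)\<^sup>2"
      by (simp add: Xx inner_simps dot_square_norm)
  qed simp
  obtain Y where Y: "selfadjoint Y" "norm Y \<le> 1" "in_bicommutant X Y"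
    "\<And>x. 2 *\<^sub>R Y x = X x + Y (Y x)"
    by (rule sqrt_one_minus_fixpoint[OF saX nX]) blast
  define R where "R = sqrt c *\<^sub>R (id_blinfun - Y)"
  have Rx: "R x = sqrt c *\<^sub>R (x - Y x)" for x by (simp add: R_def blinfun.bilinear_simps)
  show thesis
  proof
    show "selfadjoint R" using Y(1) by (simp add: adjoint_pair_def Rx inner_simps)
    show "0 \<le> inner (R x) x" for x
    proof -
      have "inner (Y x) x \<le> norm (Y x) * norm x" by (rule norm_cauchy_schwarz)
      also have "\<dots> \<le> (norm Y * norm x) * norm x" by (intro mult_right_mono norm_blinfun) simp
      also have "\<dots> \<le> (1 * norm x) * norm x" using Y(2) by (intro mult_right_mono) auto
      finally show ?thesis using c by (simp add: Rx inner_simps dot_square_norm power2_eq_square)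
    qed
    show "R (R x) = P x" for x
    proof -
      have "R (R x) = (sqrt c * sqrt c) *\<^sub>R (x - 2 *\<^sub>R Y x + Y (Y x))"
        by (simp add: Rx blinfun.bilinear_simps algebra_simps scaleR_2)
      also have "\<dots> = c *\<^sub>R (x - X x)" using c by (simp add: Y(4))
      finally show ?thesis using c by (simp add: Xx)
    qed
    show "in_bicommutant P R"
      unfolding in_bicommutant_def
    proof (intro allI impI)
      fix V W assume V: "adjoint_pair V W \<and> commutes V P"
      then have "commutes V X" by (simp add: commutes_def Xx blinfun.bilinear_simps)
      then have "commutes V Y" using V Y(3) in_bicommutantD by blast
      then show "commutes V R" by (simp add: commutes_def Rx blinfun.bilinear_simps)
    qed
  qed
qed

section \<open>Orthogonal projections onto closed subspaces\<close>

text \<open>A minimizing sequence for the distance to \<open>x\<close> is Cauchy by the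
  parallelogram law. Its limit is nearest to \<open>x\<close>, and minimality along each line
  through it in \<open>N\<close> gives orthogonality.\<close>

lemma nearest_point_in_subspace:
  fixes N :: "'a::{real_inner, banach} set"
  assumes N: "subspace N" "closed N"
  obtains p where "p \<in> N" "\<And>y. y \<in> N \<Longrightarrow> inner (x - p) y = 0"
proof -
  define g where "g y = (norm (x - y))\<^sup>2" for y
  define m where "m = Inf (g ` N)"
  have ne: "N \<noteq> {}" using N(1) subspace_0 by blast
  have bdd: "bdd_below (g ` N)" by (rule bdd_belowI2[of _ 0]) (simp add: g_def)
  have m_le: "m \<le> g y" if "y \<in> N" for y unfolding m_def by (rule cINF_lower[OF bdd that])
  have "\<exists>y\<in>N. g y < m + 1 / Suc n" for n
    using cINF_less_iff[OF ne bdd, of "m + 1 / Suc n"] by (auto simp: m_def)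
  then obtain Y where YN: "\<And>n. Y n \<in> N" and Y: "\<And>n. g (Y n) < m + 1 / Suc n" by metis
  have ineq: "(norm (y - z))\<^sup>2 \<le> 2 * ((g y - m) + (g z - m))" if "y \<in> N" "z \<in> N" for y z
  proof -
    have "(norm (y - z))\<^sup>2 = 2 * (g y + g z) - 4 * g ((1/2) *\<^sub>R (y + z))"
      by (simp add: g_def power2_norm_eq_inner inner_simps inner_commute field_simps)
    moreover have "(1/2) *\<^sub>R (y + z) \<in> N" using that N(1) by (intro subspace_scale subspace_add)
    ultimately show ?thesis using m_le[of "(1/2) *\<^sub>R (y + z)"] by simp
  qed
  have "Cauchy Y"
  proof (rule metric_CauchyI)
    fix e :: real assume e: "e > 0"
    then obtain K where K: "1 / Suc K < e\<^sup>2 / 4"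
      by (metis nat_approx_posE zero_less_power divide_pos_pos zero_less_numeral)
    have "dist (Y a) (Y b) < e" if "a \<ge> K" "b \<ge> K" for a b
    proof -
      have "1 / real (Suc a) \<le> 1 / Suc K" "1 / real (Suc b) \<le> 1 / Suc K"
        using that by (auto simp: field_simps)
      then have "(norm (Y a - Y b))\<^sup>2 < e\<^sup>2"
        using ineq[OF YN YN, of a b] Y[of a] Y[of b] K by simp
      then show ?thesis using e by (simp add: dist_norm power2_less_imp_less)
    qed
    then show "\<exists>K. \<forall>a\<ge>K. \<forall>b\<ge>K. dist (Y a) (Y b) < e" by blast
  qed
  then obtain p where p: "Y \<longlonglongrightarrow> p" by (auto simp: Cauchy_convergent_iff convergent_def)
  have pN: "p \<in> N" using closed_sequentially[OF N(2)] YN p by blast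
  have "(\<lambda>n. g (Y n)) \<longlonglongrightarrow> g p" unfolding g_def by (intro tendsto_intros p)
  moreover have "(\<lambda>n. m + 1 / Suc n) \<longlonglongrightarrow> m + 0"
    by (intro tendsto_intros LIMSEQ_Suc lim_1_over_n)
  ultimately have gp: "g p \<le> m"
    using LIMSEQ_le[of "\<lambda>n. g (Y n)" "g p" "\<lambda>n. m + 1 / Suc n" "m + 0"] Y
    by (auto intro: less_imp_le)
  have "inner (x - p) y = 0" if y: "y \<in> N" for y
  proof (rule ccontr)
    let ?d = "inner (x - p) y"
    assume d: "?d \<noteq> 0"
    then have yy: "inner y y > 0" by auto
    \<comment> \<open>The minimizer of the quadratic
      \<open>t \<mapsto> g (p + t *\<^sub>R y)\<close>, whose value there would lie strictly below
      \<open>g p\<close>.\<close>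
    define t where "t = ?d / inner y y"
    have "p + t *\<^sub>R y \<in> N" using pN y N(1) by (intro subspace_scale subspace_add)
    then have "g p \<le> g (p + t *\<^sub>R y)" using gp m_le by fastforce
    also have "\<dots> = g p - 2 * t * ?d + t * t * inner y y"
      by (simp add: g_def power2_norm_eq_inner inner_simps inner_commute algebra_simps)
    also have "\<dots> = g p - ?d * ?d / inner y y" using yy by (simp add: t_def field_simps)
    finally have "?d * ?d / inner y y \<le> 0" by simp
    moreover have "?d * ?d / inner y y > 0"
      using yy d by (intro divide_pos_pos) (auto simp: zero_less_mult_iff linorder_neq_iff)
    ultimately show False by simp
  qed
  with pN show thesis by (rule that)
qed

text \<open>Orthogonality of \<open>x - p x\<close> to \<open>N\<close> determines
  \<open>p x\<close>, so linearity follows from uniqueness; Cauchy-Schwarz for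
  \<open>inner x (p x)\<close> bounds the norm.\<close>

lemma orthogonal_projection:
  fixes N :: "'a::{real_inner, banach} set"
  assumes N: "subspace N" "closed N"
  obtains E :: "'a \<Rightarrow>\<^sub>L 'a" where "selfadjoint E" "\<And>x. E x \<in> N" "\<And>x. x \<in> N \<Longrightarrow> E x = x"
proof -
  have "\<exists>p. p \<in> N \<and> (\<forall>y\<in>N. inner (x - p) y = 0)" for x
    by (rule nearest_point_in_subspace[OF N, of x]) blast
  then obtain p where pN: "\<And>x. p x \<in> N" and orth: "\<And>x y. y \<in> N \<Longrightarrow> inner (x - p x) y = 0"
    by metis
  have uniq: "p x = z" if "z \<in> N" "\<And>y. y \<in> N \<Longrightarrow> inner (x - z) y = 0" for x z
  proof -
    have "p x - z \<in> N" using pN that(1) N(1) by (intro subspace_diff)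
    then have "inner (p x - z) (p x - z) = 0"
      using that(2) orth[of "p x - z" x] by (simp add: inner_diff_left)
    then show ?thesis by simp
  qed
  have proj: "inner (p x) y = inner x y" if "y \<in> N" for x y
    using orth[OF that, of x] by (simp add: inner_diff_left)
  have bl: "bounded_linear p"
  proof (rule bounded_linear_intro[where K = 1])
    show "p (x + y) = p x + p y" for x y
      by (rule uniq) (simp_all add: pN proj subspace_add[OF N(1)] inner_simps)
    show "p (r *\<^sub>R x) = r *\<^sub>R p x" for r x
      by (rule uniq) (simp_all add: pN proj subspace_scale[OF N(1)] inner_simps)
    show "norm (p x) \<le> norm x * 1" for x
    proof (cases "p x = 0")
      case False
      have "norm (p x) * norm (p x) = inner (p x) (p x)"
        by (simp add: dot_square_norm power2_eq_square)
      also have "\<dots> = inner x (p x)" by (rule proj[OF pN])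
      also have "\<dots> \<le> norm x * norm (p x)" by (rule norm_cauchy_schwarz)
      finally show ?thesis using False by simp
    qed simp
  qed
  note [simp] = bounded_linear_Blinfun_apply[OF bl]
  show thesis
  proof
    show "selfadjoint (Blinfun p)"
    proof (unfold adjoint_pair_def, intro allI)
      fix x y
      show "inner (Blinfun p x) y = inner x (Blinfun p y)"
        using proj[OF pN, of x y] proj[OF pN, of y x] by (simp add: inner_commute)
    qed
    show "Blinfun p x \<in> N" for x using pN by simp
    show "Blinfun p x = x" if "x \<in> N" for x using uniq[OF that] by simp
  qed
qed

definition orthoprojection :: "('a::real_inner \<Rightarrow>\<^sub>L 'a) \<Rightarrow> bool" where
  "orthoprojection E \<longleftrightarrow> selfadjoint E \<and> (\<forall>x. E (E x) = E x)"

text \<open>The cross terms vanish because \<open>A\<close> leaves both the range and the kernel of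
  \<open>E\<close> invariant. For the identity this is the theorem of Pythagoras.\<close>

lemma quadratic_form_split:
  assumes E: "orthoprojection E" and A: "commutes E A"
  shows "inner (A x) x = inner (A (E x)) (E x) + inner (A (x - E x)) (x - E x)"
proof -
  have saE: "selfadjoint E" and EE: "E (E x) = E x" for x
    using E by (auto simp: orthoprojection_def)
  have "inner (A x) (E x) = inner (E (A x)) (E x)" "inner (A (E x)) x = inner (E (A x)) (E x)"
    by (simp_all add: adjoint_pairD[OF saE] EE flip: commutesD[OF A])
  then show ?thesis using commutesD[OF A] by (simp add: inner_simps blinfun.bilinear_simps)
qed

lemma orthoprojection_pythagoras:
  assumes "orthoprojection E"
  shows "(norm x)\<^sup>2 = (norm (E x))\<^sup>2 + (norm (x - E x))\<^sup>2"
  using quadratic_form_split[OF assms, of id_blinfun x]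
  by (simp add: commutes_def power2_norm_eq_inner)

lemma orthoprojection_norm_le:
  assumes "orthoprojection E"
  shows "norm (E x) \<le> norm x" "norm (x - E x) \<le> norm x"
  using orthoprojection_pythagoras[OF assms, of x]
  by (simp_all add: power2_le_imp_le)

section \<open>Spectral projections from square roots\<close>

text \<open>Take adjoints in \<open>V A = A V\<close>. This makes invariance arguments for
  \<open>V\<close> available for its adjoint.\<close>

lemma commutes_adjoint:
  assumes "adjoint_pair V W" "selfadjoint A" "commutes V A"
  shows "commutes W A"
  unfolding commutes_def
proof
  fix x
  have "inner (W (A x)) y = inner (A (W x)) y" for y
    using adjoint_pairD[OF assms(1), of y "A x"] adjoint_pairD[OF assms(1), of "A y" x]
      adjoint_pairD[OF assms(2)] commutesD[OF assms(3), of y]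
    by (simp add: inner_commute)
  then show "W (A x) = A (W x)" by (rule inner_right_extensionality)
qed

lemma adjoint_pair_sym: "adjoint_pair V W \<Longrightarrow> adjoint_pair W V"
  by (simp add: adjoint_pair_def) (metis inner_commute)

text \<open>For \<open>B = A - l\<close> and \<open>R = |B|\<close>, the projection is the one onto the kernel of \<open>R - B\<close>.
  It contains the range of \<open>R + B\<close> as \<open>(R - B) (R + B) = 0\<close>, so \<open>B = - R\<close> on its complement.\<close>

lemma spectral_cut:
  fixes A :: "'a::{real_inner, banach} \<Rightarrow>\<^sub>L 'a" and l :: real
  assumes A: "selfadjoint A"
  obtains E where "orthoprojection E" "in_bicommutant A E"
    "\<And>x. E x = x \<Longrightarrow> l * (norm x)\<^sup>2 \<le> inner (A x) x"
    "\<And>x. E x = 0 \<Longrightarrow> inner (A x) x \<le> l * (norm x)\<^sup>2"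
proof -
  define B where "B = A - l *\<^sub>R id_blinfun"
  have Bx: "B x = A x - l *\<^sub>R x" for x by (simp add: B_def blinfun.bilinear_simps)
  have saB: "selfadjoint B" using A by (simp add: adjoint_pair_def Bx inner_simps)
  have "selfadjoint (B o\<^sub>L B)" using saB by (simp add: adjoint_pair_def)
  moreover have "0 \<le> inner ((B o\<^sub>L B) x) x" for x by (simp add: adjoint_pairD[OF saB, of "B x" x])
  ultimately obtain R where R: "selfadjoint R" "\<And>x. 0 \<le> inner (R x) x"
    and RR: "\<And>x. R (R x) = (B o\<^sub>L B) x" and bcR: "in_bicommutant (B o\<^sub>L B) R"
    by (rule positive_sqrt) blast
  have "commutes B R" by (rule in_bicommutantD[OF bcR saB]) (simp add: commutes_def)
  define N where "N = {x. R x = B x}"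
  have "subspace N"
    by (auto simp: subspace_def N_def blinfun.bilinear_simps)
  moreover have "closed N"
    unfolding N_def by (intro closed_Collect_eq continuous_intros)
  ultimately obtain E :: "'a \<Rightarrow>\<^sub>L 'a" where saE: "selfadjoint E"
    and EN: "\<And>x. E x \<in> N" and NE: "\<And>x. x \<in> N \<Longrightarrow> E x = x"
    by (rule orthogonal_projection) blast
  show thesis
  proof
    show "orthoprojection E" using saE EN NE by (simp add: orthoprojection_def)
    show "in_bicommutant A E"
      unfolding in_bicommutant_def
    proof (intro allI impI)
      fix V W assume VW: "adjoint_pair V W \<and> commutes V A"
      \<comment> \<open>What commutes with \<open>A\<close> commutes with \<open>B\<close>, hence
        with \<open>B\<^sup>2\<close> and its root \<open>R\<close>, and so preserves the kernel of
        \<open>R - B\<close>.\<close>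
      have NI: "U x \<in> N" if "adjoint_pair U U'" "commutes U A" "x \<in> N" for U U' x
      proof -
        have "commutes U B" using that(2) by (simp add: commutes_def Bx blinfun.bilinear_simps)
        then have "commutes U R"
          by (intro in_bicommutantD[OF bcR that(1)]) (simp add: commutes_def)
        then show ?thesis
          using \<open>x \<in> N\<close> commutesD[OF \<open>commutes U B\<close>, of x] commutesD[of U R x] by (simp add: N_def)
      qed
      \<comment> \<open>\<open>N\<close> is invariant under both \<open>V\<close> and
        \<open>W\<close>. The adjoint of \<open>E W E = W E\<close> is \<open>E V E = E V\<close>;
        together with \<open>E V E = V E\<close> this gives \<open>E V = V E\<close>.\<close>
      have V: "E (V (E x)) = V (E x)" for x using VW EN by (intro NE NI[of V W]) auto
      have W: "E (W (E x)) = W (E x)" for x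
        using VW EN commutes_adjoint[OF _ A] adjoint_pair_sym by (intro NE NI[of W V]) auto
      have "inner (E (V x)) y = inner (V (E x)) y" for x y
      proof -
        have "inner (E (V x)) y = inner x (W (E y))"
          using VW by (simp add: adjoint_pairD[OF saE] adjoint_pairD[of V W])
        also have "\<dots> = inner x (E (W (E y)))" by (simp only: W)
        also have "\<dots> = inner (V (E x)) (E y)"
          using VW adjoint_pairD[OF saE, of x "W (E y)"] adjoint_pairD[of V W "E x" "E y"] by simp
        also have "\<dots> = inner (V (E x)) y" by (simp add: V flip: adjoint_pairD[OF saE])
        finally show ?thesis .
      qed
      then have "E (V x) = V (E x)" for x by (rule inner_right_extensionality)
      then show "commutes V E" by (simp add: commutes_def)
    qed
    show "l * (norm x)\<^sup>2 \<le> inner (A x) x" if "E x = x" for x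
    proof -
      have "R x = B x" using EN[of x] that by (simp add: N_def)
      then show ?thesis using R(2)[of x] by (simp add: Bx inner_simps dot_square_norm)
    qed
    show "inner (A x) x \<le> l * (norm x)\<^sup>2" if "E x = 0" for x
    proof -
      have "R y + B y \<in> N" for y
        using RR commutesD[OF \<open>commutes B R\<close>] by (simp add: N_def blinfun.bilinear_simps)
      \<comment> \<open>\<open>x\<close> is orthogonal to \<open>N\<close>, hence to every
        \<open>R y + B y\<close>; the selfadjoint \<open>R + B\<close> then moves over to
        \<open>x\<close>.\<close>
      then have "inner (R x + B x) y = 0" for y
        using that adjoint_pairD[OF saE, of x "R y + B y"]
        by (simp add: NE inner_simps adjoint_pairD[OF R(1)] adjoint_pairD[OF saB])
      then have "inner (R x + B x) x = 0" .
      then show ?thesis using R(2)[of x] by (simp add: Bx inner_simps dot_square_norm)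
    qed
  qed
qed

section \<open>Finitely diagonal operators\<close>

text \<open>Diagonalizable with finitely many real eigenvalues. The span is algebraic, so no limits
  occur, and \<open>F\<close> may contain numbers that are not eigenvalues.\<close>

definition finitely_diagonal :: "('a::real_normed_vector \<Rightarrow>\<^sub>L 'a) \<Rightarrow> bool" where
  "finitely_diagonal D \<longleftrightarrow> (\<exists>F. finite F \<and> span (\<Union>\<mu>\<in>F. {x. D x = \<mu> *\<^sub>R x}) = UNIV)"

lemma finitely_diagonal_0: "finitely_diagonal 0"
  unfolding finitely_diagonal_def by (intro exI[of _ "{0}"]) simp

text \<open>Since \<open>E\<close> commutes with \<open>D\<close>, an eigenvector \<open>x\<close>
  of \<open>D\<close> splits into \<open>E x\<close> and \<open>x - E x\<close>, which satisfy the
  same eigenvalue equation for \<open>D\<close> and hence one for \<open>Q\<close> each.\<close>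

lemma finitely_diagonal_transfer:
  fixes D E Q :: "'a::real_normed_vector \<Rightarrow>\<^sub>L 'a"
  assumes D: "finitely_diagonal D" and comm: "commutes E D" and idem: "\<And>x. E (E x) = E x"
    and Q1: "\<And>\<mu> x. D x = \<mu> *\<^sub>R x \<Longrightarrow> E x = x \<Longrightarrow> Q x = a \<mu> *\<^sub>R x"
    and Q0: "\<And>\<mu> x. D x = \<mu> *\<^sub>R x \<Longrightarrow> E x = 0 \<Longrightarrow> Q x = b \<mu> *\<^sub>R x"
  shows "finitely_diagonal Q"
proof -
  obtain F where F: "finite F" "span (\<Union>\<mu>\<in>F. {x. D x = \<mu> *\<^sub>R x}) = UNIV"
    using D by (auto simp: finitely_diagonal_def)
  let ?F = "a ` F \<union> b ` F"
  let ?S = "span (\<Union>\<mu>\<in>?F. {x. Q x = \<mu> *\<^sub>R x})"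
  have "x \<in> ?S" if "\<mu> \<in> F" "D x = \<mu> *\<^sub>R x" for \<mu> x
  proof -
    have DE: "D (E x) = \<mu> *\<^sub>R E x"
      using that(2) by (simp add: blinfun.bilinear_simps flip: commutesD[OF comm])
    have "E x \<in> ?S"
      using that(1) Q1[OF DE] by (intro span_base) (auto simp: idem)
    moreover have "D (x - E x) = \<mu> *\<^sub>R (x - E x)"
      using that(2) DE by (simp add: blinfun.bilinear_simps algebra_simps)
    then have "Q (x - E x) = b \<mu> *\<^sub>R (x - E x)"
      by (rule Q0) (simp add: blinfun.bilinear_simps idem)
    then have "x - E x \<in> ?S" using that(1) by (intro span_base) auto
    ultimately have "E x + (x - E x) \<in> ?S" by (rule span_add)
    then show ?thesis by simp
  qed
  then have "span (\<Union>\<mu>\<in>F. {x. D x = \<mu> *\<^sub>R x}) \<subseteq> ?S"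
    by (intro span_minimal) (auto simp: subspace_span)
  then show ?thesis
    unfolding finitely_diagonal_def using F by (intro exI[of _ ?F]) auto
qed

section \<open>Bicommutant algebra and approximation by binary digits\<close>

lemma in_bicommutant_diff:
  "in_bicommutant A B \<Longrightarrow> in_bicommutant A C \<Longrightarrow> in_bicommutant A (B - C)"
  by (auto simp: in_bicommutant_def commutes_def blinfun.bilinear_simps)

lemma in_bicommutant_add:
  "in_bicommutant A B \<Longrightarrow> in_bicommutant A C \<Longrightarrow> in_bicommutant A (B + C)"
  by (auto simp: in_bicommutant_def commutes_def blinfun.bilinear_simps)

lemma in_bicommutant_scaleR: "in_bicommutant A B \<Longrightarrow> in_bicommutant A (r *\<^sub>R B)"
  by (auto simp: in_bicommutant_def commutes_def blinfun.bilinear_simps)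

lemma in_bicommutant_compose:
  "in_bicommutant A B \<Longrightarrow> in_bicommutant A C \<Longrightarrow> in_bicommutant A (B o\<^sub>L C)"
  by (auto simp: in_bicommutant_def commutes_def)

lemma in_bicommutant_self: "in_bicommutant A A"
  by (simp add: in_bicommutant_def)

lemma in_bicommutant_id: "in_bicommutant A id_blinfun"
  by (simp add: in_bicommutant_def commutes_def)

lemma in_bicommutant_0: "in_bicommutant A 0"
  by (simp add: in_bicommutant_def commutes_def)

lemma in_bicommutant_trans: "in_bicommutant A B \<Longrightarrow> in_bicommutant B C \<Longrightarrow> in_bicommutant A C"
  by (auto simp: in_bicommutant_def)

text \<open>\<open>A\<close> commutes with itself, hence with \<open>B\<close>; so \<open>B\<close>,
  being its own adjoint, may serve as test operator for \<open>C\<close>.\<close>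

lemma in_bicommutant_commutes:
  assumes "selfadjoint A" "selfadjoint B" "in_bicommutant A B" "in_bicommutant A C"
  shows "commutes B C"
proof -
  have "commutes A B" by (rule in_bicommutantD[OF assms(3,1) commutes_self])
  then show ?thesis by (rule in_bicommutantD[OF assms(4,2) commutes_sym])
qed

text \<open>Binary digits: subtracting \<open>t E\<close>, with \<open>E\<close> the spectral projection for the upper half of
  \<open>[0, 2 t]\<close>, halves the interval that bounds the remainder.\<close>

lemma finitely_diagonal_approximation:
  fixes A :: "'a::{real_inner, banach} \<Rightarrow>\<^sub>L 'a"
  assumes A: "selfadjoint A" and A0: "\<And>x. 0 \<le> inner (A x) x"
    and Ac: "\<And>x. inner (A x) x \<le> c * (norm x)\<^sup>2"
  shows "\<exists>D. selfadjoint D \<and> in_bicommutant A D \<and> finitely_diagonal D \<and>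
    (\<forall>x. 0 \<le> inner ((A - D) x) x \<and> inner ((A - D) x) x \<le> c / 2 ^ n * (norm x)\<^sup>2)"
proof (induction n)
  case 0
  show ?case
    using A0 Ac by (intro exI[of _ 0]) (simp add: in_bicommutant_0 finitely_diagonal_0 adjoint_pair_def)
next
  case (Suc n)
  then obtain D where D: "selfadjoint D" "in_bicommutant A D" "finitely_diagonal D"
    and D0: "\<And>x. 0 \<le> inner ((A - D) x) x"
    and Dc: "\<And>x. inner ((A - D) x) x \<le> c / 2 ^ n * (norm x)\<^sup>2" by blast
  define t where "t = c / 2 ^ Suc n"
  have t: "c / 2 ^ n = 2 * t" by (simp add: t_def)
  have saB: "selfadjoint (A - D)"
    using A D(1) by (simp add: adjoint_pair_def blinfun.bilinear_simps inner_simps)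
  obtain E where E: "orthoprojection E" and bE: "in_bicommutant (A - D) E"
    and E1: "\<And>x. E x = x \<Longrightarrow> t * (norm x)\<^sup>2 \<le> inner ((A - D) x) x"
    and E0: "\<And>x. E x = 0 \<Longrightarrow> inner ((A - D) x) x \<le> t * (norm x)\<^sup>2"
    by (rule spectral_cut[OF saB, of t]) blast
  have saE: "selfadjoint E" and EE: "E (E x) = E x" for x
    using E by (auto simp: orthoprojection_def)
  have bAE: "in_bicommutant A E"
    by (rule in_bicommutant_trans[OF in_bicommutant_diff bE]) (use D in_bicommutant_self in auto)
  have ED: "commutes E D" by (rule in_bicommutant_commutes[OF A saE bAE D(2)])
  have EB: "commutes E (A - D)" by (rule commutes_sym, rule in_bicommutantD[OF bE saB commutes_self])
  \<comment> \<open>On the range of \<open>E\<close> the remainder has its form in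
    \<open>[t, 2 t]\<close> and loses \<open>t\<close>; on the kernel it already lies in
    \<open>[0, t]\<close>.\<close>
  have form: "inner ((A - (D + t *\<^sub>R E)) x) x = (inner ((A - D) (E x)) (E x) - t * (norm (E x))\<^sup>2)
      + inner ((A - D) (x - E x)) (x - E x)" for x
  proof -
    have "inner (E x) x = (norm (E x))\<^sup>2"
      using adjoint_pairD[OF saE, of x "E x"] adjoint_pairD[OF saE, of x x]
      by (simp add: EE power2_norm_eq_inner inner_commute)
    moreover have "inner ((A - (D + t *\<^sub>R E)) x) x = inner ((A - D) x) x - t * inner (E x) x"
      by (simp add: blinfun.bilinear_simps inner_simps)
    ultimately show ?thesis using quadratic_form_split[OF E EB, of x] by simp
  qed
  show ?case
  proof (intro exI conjI allI)
    show "selfadjoint (D + t *\<^sub>R E)"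
      using D(1) saE by (simp add: adjoint_pair_def blinfun.bilinear_simps inner_simps)
    show "in_bicommutant A (D + t *\<^sub>R E)"
      by (intro in_bicommutant_add in_bicommutant_scaleR D bAE)
    \<comment> \<open>Adding \<open>t E\<close> raises an eigenvalue by \<open>t\<close> on the
      range of \<open>E\<close> and keeps it on the kernel.\<close>
    show "finitely_diagonal (D + t *\<^sub>R E)"
      by (rule finitely_diagonal_transfer[OF D(3) ED EE, where a = "\<lambda>\<mu>. \<mu> + t" and b = id])
        (simp_all add: blinfun.bilinear_simps algebra_simps)
    fix x
    have Ex: "E (x - E x) = 0" by (simp add: blinfun.bilinear_simps EE)
    show "0 \<le> inner ((A - (D + t *\<^sub>R E)) x) x"
      unfolding form using E1[OF EE, of x] D0[of "x - E x"] by simp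
    show "inner ((A - (D + t *\<^sub>R E)) x) x \<le> c / 2 ^ Suc n * (norm x)\<^sup>2"
      unfolding form t_def[symmetric] using Dc[of "E x"] E0[OF Ex] orthoprojection_pythagoras[OF E, of x]
      by (simp add: t algebra_simps)
  qed
qed

section \<open>Coercive inverses and approximation of the given operator\<close>

text \<open>The Neumann series as a fixed point: \<open>Z = 1 - C / K\<close> is a strict
  contraction, and \<open>Y = 1 + Z Y\<close> says \<open>C Y = K\<close>.\<close>

lemma coercive_inverse:
  fixes C :: "'a::{real_inner, banach} \<Rightarrow>\<^sub>L 'a"
  assumes C: "selfadjoint C" and d: "0 < d" and Cd: "\<And>x. d * (norm x)\<^sup>2 \<le> inner (C x) x"
  obtains R where "selfadjoint R" "\<And>x. C (R x) = x" "\<And>x. R (C x) = x" "in_bicommutant C R"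
proof -
  \<comment> \<open>Adding \<open>d\<close> makes \<open>K\<close> positive and at least
    \<open>d\<close>, so that the bound \<open>1 - d / K\<close> lies in
    \<open>[0, 1)\<close>.\<close>
  define K where "K = norm C + d"
  have K: "K > 0" "d \<le> K" using d by (auto simp: K_def add_nonneg_pos)
  define Z where "Z = id_blinfun - (1 / K) *\<^sub>R C"
  have Zx: "Z x = x - (1 / K) *\<^sub>R C x" for x by (simp add: Z_def blinfun.bilinear_simps)
  have "norm Z \<le> 1 - d / K"
  proof (rule norm_le_quadratic_form)
    show "selfadjoint Z" using C by (simp add: adjoint_pair_def Zx inner_simps)
    show "0 \<le> 1 - d / K" using K by simp
    fix x
    have "inner (C x) x \<le> norm (C x) * norm x" by (rule norm_cauchy_schwarz)
    also have "\<dots> \<le> (norm C * norm x) * norm x" by (intro mult_right_mono norm_blinfun) simp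
    also have "\<dots> \<le> K * (norm x)\<^sup>2" using d by (simp add: K_def power2_eq_square algebra_simps)
    finally have "inner (C x) x / K \<le> (norm x)\<^sup>2" using K by (simp add: field_simps)
    moreover have "d * (norm x)\<^sup>2 / K \<le> inner (C x) x / K"
      using Cd[of x] K by (intro divide_right_mono) auto
    ultimately show "\<bar>inner (Z x) x\<bar> \<le> (1 - d / K) * (norm x)\<^sup>2"
      by (simp add: Zx inner_simps dot_square_norm algebra_simps)
  qed
  then have nZ: "norm Z < 1" using d K by (smt (verit) divide_pos_pos)
  have "\<exists>!Y. id_blinfun + (Z o\<^sub>L Y) = Y"
  proof (rule banach_fix_type[of "norm Z"])
    show "\<forall>X Y. dist (id_blinfun + (Z o\<^sub>L X)) (id_blinfun + (Z o\<^sub>L Y)) \<le> norm Z * dist X Y"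
      by (simp add: dist_norm norm_blinfun_compose
          flip: bounded_bilinear.diff_right[OF bounded_bilinear_blinfun_compose])
  qed (use nZ in auto)
  then obtain Y where Y: "id_blinfun + (Z o\<^sub>L Y) = Y" by blast
  have CY: "C (Y x) = K *\<^sub>R x" for x
  proof -
    have "x + Z (Y x) = Y x" using arg_cong[OF Y, of "\<lambda>T. T x"] by (simp add: blinfun.bilinear_simps)
    then have "(1 / K) *\<^sub>R C (Y x) = x" by (simp add: Zx algebra_simps)
    then show ?thesis using K by (metis divideR_right less_irrefl inverse_eq_divide)
  qed
  define R where "R = (1 / K) *\<^sub>R Y"
  have CR: "C (R x) = x" for x using K by (simp add: R_def blinfun.bilinear_simps CY)
  have saR: "selfadjoint R"
    unfolding adjoint_pair_def
  proof (intro allI)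
    show "inner (R x) y = inner x (R y)" for x y
      using adjoint_pairD[OF C, of "R x" "R y"] by (simp add: CR)
  qed
  \<comment> \<open>The adjoint of \<open>C R = 1\<close>, both factors being selfadjoint.\<close>
  have RC: "R (C x) = x" for x
  proof -
    have "inner (R (C x)) y = inner x y" for y by (simp add: adjoint_pairD[OF saR] adjoint_pairD[OF C] CR)
    then show ?thesis by (rule inner_right_extensionality)
  qed
  have "V (R x) = R (V x)" if "commutes V C" for V x
  proof -
    have "V (R x) = R (C (V (R x)))" by (simp only: RC)
    also have "\<dots> = R (V x)" by (simp add: CR flip: commutesD[OF that])
    finally show ?thesis .
  qed
  then have "in_bicommutant C R" by (simp add: in_bicommutant_def commutes_def)
  with saR CR RC show thesis by (rule that)
qed

text \<open>The approximant is \<open>T G\<close> and \<open>Q\<close> is its Gram operator.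
  Membership of \<open>G\<close> in the bicommutant is recorded because complex linearity of
  \<open>G\<close> will be derived from it.\<close>

lemma finitely_diagonal_gram_approximation:
  fixes T :: "'a::{real_inner, banach} \<Rightarrow>\<^sub>L 'a"
  assumes T: "adjoint_pair T T'" and e: "0 < e"
  obtains G Q :: "'a \<Rightarrow>\<^sub>L 'a" where "in_bicommutant (T' o\<^sub>L T) G" "norm (T - (T o\<^sub>L G)) \<le> e"
    "\<And>x y. inner (T (G x)) (T (G y)) = inner (Q x) y" "selfadjoint Q" "finitely_diagonal Q"
proof -
  let ?P = "T' o\<^sub>L T"
  have TT: "inner (T' (T x)) y = inner (T x) (T y)" for x y
    using adjoint_pairD[OF adjoint_pair_sym[OF T]] by simp
  have "selfadjoint ?P" by (simp add: adjoint_pair_def TT) (metis TT inner_commute)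
  moreover have "0 \<le> inner (?P x) x" for x by (simp add: TT)
  ultimately obtain A where A: "selfadjoint A" and A0: "\<And>x. 0 \<le> inner (A x) x"
    and AA: "\<And>x. A (A x) = ?P x" and bA: "in_bicommutant ?P A"
    by (rule positive_sqrt) blast
  \<comment> \<open>\<open>T\<close> and its modulus \<open>A\<close> induce the same inner
    products, so errors of the form \<open>T z\<close> can be measured as
    \<open>A z\<close>.\<close>
  have TA: "inner (T x) (T y) = inner (A x) (A y)" for x y
    using AA[of x] by (simp add: adjoint_pairD[OF A, symmetric] flip: TT)
  obtain E where E: "orthoprojection E" and bE: "in_bicommutant A E"
    and E1: "\<And>x. E x = x \<Longrightarrow> e / 2 * (norm x)\<^sup>2 \<le> inner (A x) x"
    and E0: "\<And>x. E x = 0 \<Longrightarrow> inner (A x) x \<le> e / 2 * (norm x)\<^sup>2"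
    by (rule spectral_cut[OF A, of "e / 2"]) blast
  have saE: "selfadjoint E" and EE: "E (E x) = E x" for x
    using E by (auto simp: orthoprojection_def)
  have EA: "commutes E A" by (rule in_bicommutant_commutes[OF A saE bE in_bicommutant_self])
  \<comment> \<open>This is max(A, \<delta>) for \<delta> = \<open>e / 2\<close>: it agrees with
    \<open>A\<close> on the range of \<open>E\<close> and is \<delta> on the kernel.\<close>
  define C where "C = (A o\<^sub>L E) + (e / 2) *\<^sub>R (id_blinfun - E)"
  have Cx: "C x = A (E x) + (e / 2) *\<^sub>R (x - E x)" for x
    by (simp add: C_def blinfun.bilinear_simps)
  have bC: "in_bicommutant A C"
    unfolding C_def by (intro in_bicommutant_add in_bicommutant_scaleR in_bicommutant_diff
        in_bicommutant_compose in_bicommutant_self in_bicommutant_id bE)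
  have saC: "selfadjoint C"
    by (simp add: adjoint_pair_def Cx inner_simps adjoint_pairD[OF saE] adjoint_pairD[OF A]
        commutesD[OF EA])
  have "e / 2 * (norm x)\<^sup>2 \<le> inner (C x) x" for x
  proof -
    have "inner (C x) x = inner (A (E x)) (E x) + e / 2 * (norm (x - E x))\<^sup>2"
      by (subst quadratic_form_split[OF E in_bicommutant_commutes[OF A saE bE bC]])
        (simp add: Cx EE blinfun.bilinear_simps power2_norm_eq_inner)
    then show ?thesis
      using E1[OF EE, of x] orthoprojection_pythagoras[OF E, of x] by (simp add: algebra_simps)
  qed
  then obtain R where saR: "selfadjoint R" and CR: "\<And>x. C (R x) = x" and bR: "in_bicommutant C R"
    by (rule coercive_inverse[OF saC half_gt_zero[OF e]]) blast
  have bAR: "in_bicommutant A R" by (rule in_bicommutant_trans[OF bC bR])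
  have ER: "commutes E R" by (rule in_bicommutant_commutes[OF A saE bE bAR])
  have ARE: "A (R (E x)) = E x" for x
  proof -
    have "A (R (E x)) = C (R (E x))"
      by (simp add: Cx EE commutesD[OF ER])
    then show ?thesis by (simp add: CR)
  qed
  have Ac: "inner (A x) x \<le> norm A * (norm x)\<^sup>2" for x
  proof -
    have "inner (A x) x \<le> norm (A x) * norm x" by (rule norm_cauchy_schwarz)
    also have "\<dots> \<le> (norm A * norm x) * norm x" by (intro mult_right_mono norm_blinfun) simp
    finally show ?thesis by (simp add: power2_eq_square)
  qed
  \<comment> \<open>Half of \<open>e\<close> is for the error \<open>A - D\<close>, the other half
    for the part of \<open>A\<close> cut off by \<open>E\<close>.\<close>
  obtain n where n: "norm A / 2 ^ n < e / 2"
  proof -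
    obtain n where "norm A / (e / 2) < 2 ^ n" using real_arch_pow[of 2] by auto
    then show thesis using e by (intro that[of n]) (simp add: field_simps)
  qed
  obtain D where D: "selfadjoint D" "in_bicommutant A D" "finitely_diagonal D"
    and D0: "\<And>x. 0 \<le> inner ((A - D) x) x"
    and Dn: "\<And>x. inner ((A - D) x) x \<le> norm A / 2 ^ n * (norm x)\<^sup>2"
    using finitely_diagonal_approximation[OF A A0 Ac, of n] by blast
  have ED: "commutes E D" by (rule in_bicommutant_commutes[OF A saE bE D(2)])
  have nAD: "norm (A - D) \<le> norm A / 2 ^ n"
    by (rule norm_le_quadratic_form)
      (use A D(1) D0 Dn in \<open>auto simp: adjoint_pair_def blinfun.bilinear_simps inner_simps\<close>)
  have nAE: "norm (A o\<^sub>L (id_blinfun - E)) \<le> e / 2"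
  proof (rule norm_le_quadratic_form)
    \<comment> \<open>As \<open>E\<close> commutes with \<open>A\<close>, the form of
      \<open>A (1 - E)\<close> is that of \<open>A\<close> on the kernel of \<open>E\<close>, where
      \<open>E0\<close> applies.\<close>
    have "inner ((A o\<^sub>L (id_blinfun - E)) x) x = inner (A (x - E x)) (x - E x)" for x
      using commutesD[OF EA] adjoint_pairD[OF saE, of "A x" x] adjoint_pairD[OF saE, of "A (E x)" x]
      by (simp add: blinfun.bilinear_simps inner_simps EE)
    moreover have "inner (A (x - E x)) (x - E x) \<le> e / 2 * (norm x)\<^sup>2" for x
    proof -
      have "inner (A (x - E x)) (x - E x) \<le> e / 2 * (norm (x - E x))\<^sup>2"
        by (rule E0) (simp add: blinfun.bilinear_simps EE)
      also have "\<dots> \<le> e / 2 * (norm x)\<^sup>2"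
        using e orthoprojection_norm_le[OF E] by (intro mult_left_mono power_mono) auto
      finally show ?thesis .
    qed
    ultimately show "\<bar>inner ((A o\<^sub>L (id_blinfun - E)) x) x\<bar> \<le> e / 2 * (norm x)\<^sup>2" for x
      using A0[of "x - E x"] by simp
  qed (use e in \<open>auto simp: adjoint_pair_def blinfun.bilinear_simps inner_simps
      adjoint_pairD[OF saE] adjoint_pairD[OF A] commutesD[OF EA]\<close>)
  define G where "G = R o\<^sub>L E o\<^sub>L D"
  define Q where "Q = D o\<^sub>L E o\<^sub>L D"
  show thesis
  proof
    show "in_bicommutant ?P G"
      unfolding G_def by (rule in_bicommutant_trans[OF bA]) (intro in_bicommutant_compose bAR bE D)
    show "norm (T - (T o\<^sub>L G)) \<le> e"
    proof (rule norm_blinfun_bound)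
      fix x
      have "norm ((T - (T o\<^sub>L G)) x) = norm (T (x - G x))" by (simp add: blinfun.bilinear_simps)
      also have "\<dots> = norm (A (x - G x))" by (simp add: norm_eq_sqrt_inner TA)
      \<comment> \<open>By \<open>A R E = E\<close>, \<open>A - A G = A - E D\<close>, which is
        \<open>A (1 - E) + E (A - D)\<close>.\<close>
      also have "A (x - G x) = (A o\<^sub>L (id_blinfun - E)) x + E ((A - D) x)"
        by (simp add: G_def ARE blinfun.bilinear_simps commutesD[OF EA])
      also have "norm \<dots> \<le> e / 2 * norm x + norm ((A - D) x)"
      proof (rule norm_triangle_le, rule add_mono)
        show "norm ((A o\<^sub>L (id_blinfun - E)) x) \<le> e / 2 * norm x"
          by (rule order_trans[OF norm_blinfun mult_right_mono[OF nAE]]) simp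
      qed (rule orthoprojection_norm_le[OF E])
      also have "norm ((A - D) x) \<le> e / 2 * norm x"
        using nAD n by (intro order_trans[OF norm_blinfun mult_right_mono] norm_ge_zero) linarith
      finally show "norm ((T - (T o\<^sub>L G)) x) \<le> e * norm x" by (simp add: algebra_simps)
    qed (use e in simp)
    show "inner (T (G x)) (T (G y)) = inner (Q x) y" for x y
      by (simp add: TA G_def Q_def ARE adjoint_pairD[OF saE] adjoint_pairD[OF D(1)] EE)
    show "selfadjoint Q"
      by (simp add: adjoint_pair_def Q_def adjoint_pairD[OF saE] adjoint_pairD[OF D(1)])
    \<comment> \<open>\<open>D E D\<close> has eigenvalue \<open>\<mu> * \<mu>\<close> on the range
      of \<open>E\<close> and 0 on its kernel.\<close>
    show "finitely_diagonal Q"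
      by (rule finitely_diagonal_transfer[OF D(3) ED EE, where a = "\<lambda>\<mu>. \<mu> * \<mu>" and b = "\<lambda>_. 0"])
        (simp_all add: Q_def blinfun.bilinear_simps commutesD[OF ED])
  qed
qed

section \<open>Minimum of a finitely diagonal form on an invariant subspace\<close>

text \<open>Sums with one term per member of \<open>F\<close> form a subspace, since terms for the
  same number can be merged; it contains all the eigenvectors that span.\<close>

lemma finitely_diagonal_decomposition:
  assumes "finitely_diagonal D"
  obtains F where "finite F"
    "\<And>x. \<exists>f. (\<forall>\<mu>\<in>F. D (f \<mu>) = \<mu> *\<^sub>R f \<mu>) \<and> x = (\<Sum>\<mu>\<in>F. f \<mu>)"
proof -
  obtain F where F: "finite F" "span (\<Union>\<mu>\<in>F. {x. D x = \<mu> *\<^sub>R x}) = UNIV"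
    using assms by (auto simp: finitely_diagonal_def)
  let ?S = "{x. \<exists>f. (\<forall>\<mu>\<in>F. D (f \<mu>) = \<mu> *\<^sub>R f \<mu>) \<and> x = (\<Sum>\<mu>\<in>F. f \<mu>)}"
  have "subspace ?S"
    unfolding subspace_def
  proof (intro conjI ballI allI)
    show "0 \<in> ?S" by (auto intro!: exI[of _ "\<lambda>_. 0"])
  next
    fix x y assume "x \<in> ?S" "y \<in> ?S"
    then obtain f g where
      "\<forall>\<mu>\<in>F. D (f \<mu>) = \<mu> *\<^sub>R f \<mu>" "x = (\<Sum>\<mu>\<in>F. f \<mu>)"
      "\<forall>\<mu>\<in>F. D (g \<mu>) = \<mu> *\<^sub>R g \<mu>" "y = (\<Sum>\<mu>\<in>F. g \<mu>)" by blast
    then show "x + y \<in> ?S"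
      by (auto intro!: exI[of _ "\<lambda>\<mu>. f \<mu> + g \<mu>"]
          simp: blinfun.bilinear_simps sum.distrib algebra_simps)
  next
    fix r x assume "x \<in> ?S"
    then obtain f where "\<forall>\<mu>\<in>F. D (f \<mu>) = \<mu> *\<^sub>R f \<mu>" "x = (\<Sum>\<mu>\<in>F. f \<mu>)" by blast
    then show "r *\<^sub>R x \<in> ?S"
      by (auto intro!: exI[of _ "\<lambda>\<mu>. r *\<^sub>R f \<mu>"]
          simp: blinfun.bilinear_simps scaleR_sum_right)
  qed
  moreover have "x \<in> ?S" if "\<mu> \<in> F" "D x = \<mu> *\<^sub>R x" for \<mu> x
    using that F(1) by (auto intro!: exI[of _ "\<lambda>\<nu>. if \<nu> = \<mu> then x else 0"])
  ultimately have "span (\<Union>\<mu>\<in>F. {x. D x = \<mu> *\<^sub>R x}) \<subseteq> ?S"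
    by (intro span_minimal) auto
  then show thesis using F by (intro that[of F]) auto
qed

text \<open>Induction on \<open>F\<close>: \<open>Q - \<nu>\<close> removes the component for \<nu>
  and multiplies the others by the nonzero \<open>\<mu> - \<nu>\<close>, so these lie in
  \<open>M\<close>; the removed one is the difference.\<close>

lemma eigencomponent_in_invariant_subspace:
  fixes Q :: "'a::real_normed_vector \<Rightarrow>\<^sub>L 'a"
  assumes M: "subspace M" "\<And>x. x \<in> M \<Longrightarrow> Q x \<in> M"
    and F: "finite F" "\<And>\<mu>. \<mu> \<in> F \<Longrightarrow> Q (f \<mu>) = \<mu> *\<^sub>R f \<mu>" "(\<Sum>\<mu>\<in>F. f \<mu>) \<in> M"
    and "\<mu> \<in> F"
  shows "f \<mu> \<in> M"
  using F \<open>\<mu> \<in> F\<close>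
proof (induction F arbitrary: f \<mu> rule: finite_induct)
  case (insert \<nu> F)
  let ?x = "\<Sum>\<mu>\<in>insert \<nu> F. f \<mu>"
  have "Q ?x - \<nu> *\<^sub>R ?x = (\<Sum>\<mu>\<in>F. (\<mu> - \<nu>) *\<^sub>R f \<mu>)"
    using insert.hyps insert.prems(1)
    by (simp add: blinfun.bilinear_simps blinfun.sum_right scaleR_sum_right algebra_simps
        flip: sum_subtractf)
  moreover have "Q ?x - \<nu> *\<^sub>R ?x \<in> M"
    using insert.prems(2) M by (intro subspace_diff subspace_scale)
  ultimately have "(\<mu> - \<nu>) *\<^sub>R f \<mu> \<in> M" if "\<mu> \<in> F" for \<mu>
    using insert.prems(1) that
    by (intro insert.IH[of "\<lambda>\<mu>. (\<mu> - \<nu>) *\<^sub>R f \<mu>"]) (auto simp: blinfun.bilinear_simps)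
  then have fM: "f \<mu> \<in> M" if "\<mu> \<in> F" for \<mu>
    using subspace_scale[OF M(1), of "(\<mu> - \<nu>) *\<^sub>R f \<mu>" "1 / (\<mu> - \<nu>)"] that insert.hyps
    by (auto split: if_splits)
  have "?x - (\<Sum>\<mu>\<in>F. f \<mu>) \<in> M"
    by (rule subspace_diff[OF M(1) insert.prems(2) subspace_sum[OF M(1) fM]])
  moreover have "?x - (\<Sum>\<mu>\<in>F. f \<mu>) = f \<nu>" using insert.hyps by simp
  ultimately have "f \<nu> \<in> M" by metis
  then show ?case using fM insert.prems(3) by auto
qed simp

text \<open>The eigencomponents of a vector of \<open>M\<close> lie in \<open>M\<close> and are
  orthogonal, so the form is the sum of \<open>\<mu> * (norm (f \<mu>))\<^sup>2\<close>, at least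
  the smallest eigenvalue in \<open>M\<close> times \<open>(norm x)\<^sup>2\<close>.\<close>

lemma finitely_diagonal_form_attains_min:
  fixes Q :: "'a::real_inner \<Rightarrow>\<^sub>L 'a"
  assumes Q: "selfadjoint Q" "finitely_diagonal Q"
    and M: "subspace M" "M \<noteq> {0}" "\<And>x. x \<in> M \<Longrightarrow> Q x \<in> M"
  obtains u where "u \<in> M" "norm u = 1"
    "\<And>x. x \<in> M \<Longrightarrow> inner (Q u) u * (norm x)\<^sup>2 \<le> inner (Q x) x"
proof -
  obtain F where F: "finite F"
    and dec: "\<And>x. \<exists>f. (\<forall>\<mu>\<in>F. Q (f \<mu>) = \<mu> *\<^sub>R f \<mu>) \<and> x = (\<Sum>\<mu>\<in>F. f \<mu>)"
    by (rule finitely_diagonal_decomposition[OF Q(2)]) blast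
  define L where "L = {\<mu>\<in>F. \<exists>u\<in>M. u \<noteq> 0 \<and> Q u = \<mu> *\<^sub>R u}"
  have decM: "\<exists>f. (\<forall>\<mu>\<in>F. f \<mu> \<in> M \<and> Q (f \<mu>) = \<mu> *\<^sub>R f \<mu>) \<and> x = (\<Sum>\<mu>\<in>F. f \<mu>)"
    if x: "x \<in> M" for x
  proof -
    obtain f where f: "(\<forall>\<mu>\<in>F. Q (f \<mu>) = \<mu> *\<^sub>R f \<mu>) \<and> x = (\<Sum>\<mu>\<in>F. f \<mu>)"
      using dec[of x] ..
    have "f \<mu> \<in> M" if "\<mu> \<in> F" for \<mu>
      using f x that
      by (intro eigencomponent_in_invariant_subspace[OF M(1,3) F, where f = f]) simp_all
    with f show ?thesis by (intro exI[of _ f]) simp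
  qed
  obtain z where "z \<in> M" "z \<noteq> 0" using M(1,2) subspace_0 by blast
  have "L \<noteq> {}"
  proof
    assume "L = {}"
    obtain f where f: "(\<forall>\<mu>\<in>F. f \<mu> \<in> M \<and> Q (f \<mu>) = \<mu> *\<^sub>R f \<mu>) \<and> z = (\<Sum>\<mu>\<in>F. f \<mu>)"
      using decM[OF \<open>z \<in> M\<close>] ..
    then have "\<forall>\<mu>\<in>F. f \<mu> = 0" using \<open>L = {}\<close> by (auto simp: L_def)
    with f \<open>z \<noteq> 0\<close> show False by simp
  qed
  moreover have "finite L" using F by (simp add: L_def)
  ultimately have "Min L \<in> L" and Min_le: "\<And>\<mu>. \<mu> \<in> L \<Longrightarrow> Min L \<le> \<mu>" by auto
  then obtain v where v: "v \<in> M" "v \<noteq> 0" "Q v = Min L *\<^sub>R v" by (auto simp: L_def)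
  define u where "u = (1 / norm v) *\<^sub>R v"
  have u: "u \<in> M" "norm u = 1" "Q u = Min L *\<^sub>R u"
    using v M(1) by (simp_all add: u_def subspace_scale blinfun.bilinear_simps)
  have Quu: "inner (Q u) u = Min L" by (simp add: u dot_square_norm)
  show thesis
  proof
    fix x assume "x \<in> M"
    obtain f where "(\<forall>\<mu>\<in>F. f \<mu> \<in> M \<and> Q (f \<mu>) = \<mu> *\<^sub>R f \<mu>) \<and> x = (\<Sum>\<mu>\<in>F. f \<mu>)"
      using decM[OF \<open>x \<in> M\<close>] ..
    then have f: "\<And>\<mu>. \<mu> \<in> F \<Longrightarrow> f \<mu> \<in> M" "\<And>\<mu>. \<mu> \<in> F \<Longrightarrow> Q (f \<mu>) = \<mu> *\<^sub>R f \<mu>"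
      and x: "x = (\<Sum>\<mu>\<in>F. f \<mu>)" by auto
    have orth: "inner (f \<mu>) (f \<nu>) = 0" if "\<mu> \<in> F" "\<nu> \<in> F" "\<mu> \<noteq> \<nu>" for \<mu> \<nu>
      using adjoint_pairD[OF Q(1), of "f \<mu>" "f \<nu>"] that f(2) by simp
    have fx: "inner (f \<mu>) x = (norm (f \<mu>))\<^sup>2" if "\<mu> \<in> F" for \<mu>
    proof -
      have "inner (f \<mu>) x = (\<Sum>\<nu>\<in>F. if \<nu> = \<mu> then inner (f \<mu>) (f \<mu>) else 0)"
        unfolding x inner_sum_right using orth[OF that] by (intro sum.cong) auto
      then show ?thesis using F that by (simp add: power2_norm_eq_inner)
    qed
    have "inner (Q u) u * (norm x)\<^sup>2 = Min L * inner (\<Sum>\<mu>\<in>F. f \<mu>) x"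
      by (simp add: Quu power2_norm_eq_inner flip: x)
    also have "\<dots> = (\<Sum>\<mu>\<in>F. Min L * (norm (f \<mu>))\<^sup>2)"
      by (simp add: inner_sum_left fx sum_distrib_left)
    also have "\<dots> \<le> (\<Sum>\<mu>\<in>F. \<mu> * (norm (f \<mu>))\<^sup>2)"
    proof (rule sum_mono)
      fix \<mu> assume \<mu>: "\<mu> \<in> F"
      \<comment> \<open>A member of \<open>F\<close> whose component is 0 may lie outside
        \<open>L\<close>, even below \<open>Min L\<close>, but contributes nothing.\<close>
      show "Min L * (norm (f \<mu>))\<^sup>2 \<le> \<mu> * (norm (f \<mu>))\<^sup>2"
      proof (cases "f \<mu> = 0")
        case False
        then have "\<mu> \<in> L" using \<mu> f by (auto simp: L_def)
        then show ?thesis using Min_le by (intro mult_right_mono) auto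
      qed simp
    qed
    also have "\<dots> = inner (\<Sum>\<mu>\<in>F. Q (f \<mu>)) x"
      by (simp add: inner_sum_left f(2) fx)
    also have "(\<Sum>\<mu>\<in>F. Q (f \<mu>)) = Q x" unfolding x by (simp add: blinfun.sum_right)
    finally show "inner (Q u) u * (norm x)\<^sup>2 \<le> inner (Q x) x" .
  qed (use u in auto)
qed

section \<open>Complex linearity and reducing subspaces\<close>

instance complex_hilbert \<subseteq> banach ..

lemma adjoint_pair_cadjoint:
  fixes T :: "'a::complex_hilbert \<Rightarrow>\<^sub>L 'a"
  shows "T \<in> bounded_ops \<Longrightarrow> adjoint_pair T (cadjoint T)"
  using is_cadjoint_cadjoint[of T] by (simp add: is_cadjoint_def adjoint_pair_def inner_eq_Re_cinner)

lemma norm_scaleC: "norm (c *\<^sub>C x) = cmod c * norm (x :: 'a::complex_inner)"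
proof -
  have "cinner (c *\<^sub>C x) (c *\<^sub>C x) = (c * cnj c) * cinner x x"
    by (simp add: cinner_scaleC_left cinner_scaleC_right)
  also have "c * cnj c = complex_of_real ((cmod c)\<^sup>2)" by (rule complex_norm_square[symmetric])
  finally have "inner (c *\<^sub>C x) (c *\<^sub>C x) = (cmod c)\<^sup>2 * inner x x"
    by (simp add: inner_eq_Re_cinner)
  then show ?thesis by (simp add: norm_eq_sqrt_inner real_sqrt_mult)
qed

lemma bounded_linear_scaleC: "bounded_linear (\<lambda>x :: 'a::complex_inner. c *\<^sub>C x)"
  by (rule bounded_linear_intro[where K = "cmod c"])
    (simp_all add: scaleC_add_right scaleR_scaleC scaleC_scaleC norm_scaleC mult.commute)

text \<open>Multiplication by \<open>c\<close> has multiplication by \<open>cnj c\<close> as adjoint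
  and commutes with the complex-linear \<open>P\<close>, hence with \<open>G\<close>.\<close>

lemma bounded_ops_in_bicommutant:
  fixes P :: "'a::complex_hilbert \<Rightarrow>\<^sub>L 'a"
  assumes P: "P \<in> bounded_ops" and G: "in_bicommutant P G"
  shows "G \<in> bounded_ops"
proof -
  have "G (c *\<^sub>C x) = c *\<^sub>C G x" for c x
  proof -
    let ?J = "\<lambda>c. Blinfun (\<lambda>x :: 'a. c *\<^sub>C x)"
    note [simp] = bounded_linear_Blinfun_apply[OF bounded_linear_scaleC]
    have "adjoint_pair (?J c) (?J (cnj c))"
      by (simp add: adjoint_pair_def inner_eq_Re_cinner cinner_scaleC_left cinner_scaleC_right)
    moreover have "commutes (?J c) P" using P by (simp add: commutes_def bounded_ops_def)
    ultimately have "commutes (?J c) G" by (rule in_bicommutantD[OF G])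
    then show ?thesis by (simp add: commutes_def)
  qed
  then show ?thesis by (simp add: bounded_ops_def)
qed

text \<open>\<open>Q\<close> must be \<open>S\<^sup>* S\<close>, so it maps a reducing
  \<open>M\<close> into itself. As \<open>(norm (S x))\<^sup>2 = inner (Q x) x\<close>, a unit
  vector minimizing the form minimizes \<open>norm (S x)\<close>.\<close>

lemma min_attaining_reducing_if_gram_finitely_diagonal:
  fixes S Q :: "'a::complex_hilbert \<Rightarrow>\<^sub>L 'a"
  assumes S: "S \<in> bounded_ops" and Q: "selfadjoint Q" "finitely_diagonal Q"
    and SQ: "\<And>x y. inner (S x) (S y) = inner (Q x) y"
  shows "S \<in> min_attaining_reducing"
  unfolding min_attaining_reducing_def
proof (intro CollectI conjI S allI impI)
  fix M assume M: "closed_csubspace M \<and> M \<noteq> {0} \<and> reduces M S"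
  then have "complex_vector.subspace M" by (simp add: closed_csubspace_def)
  then have "subspace M"
    by (auto simp: subspace_def complex_vector.subspace_def scaleR_scaleC)
  have "inner (Q x) y = inner (cadjoint S (S x)) y" for x y
    using adjoint_pairD[OF adjoint_pair_sym[OF adjoint_pair_cadjoint[OF S]], of "S x" y]
    by (simp add: SQ)
  then have "Q x = cadjoint S (S x)" for x
    by (rule inner_right_extensionality)
  then have "Q x \<in> M" if "x \<in> M" for x using that M by (auto simp: reduces_def)
  then obtain u where u: "u \<in> M" "norm u = 1"
    and min: "\<And>x. x \<in> M \<Longrightarrow> inner (Q u) u * (norm x)\<^sup>2 \<le> inner (Q x) x"
    using finitely_diagonal_form_attains_min[OF Q \<open>subspace M\<close>] M by metis
  have "norm (S u) \<le> norm (S x)" if "x \<in> M" "norm x = 1" for x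
    using min[OF that(1)] that(2) by (simp add: norm_eq_sqrt_inner SQ)
  then have "min_modulus M S = norm (S u)"
    unfolding min_modulus_def using u by (intro cInf_eq_minimum) auto
  then show "minimum_attaining M S" using u by (auto simp: minimum_attaining_def)
qed

theorem theorem5p9:
  assumes "infinite_dimensional TYPE('a::complex_hilbert)"
    and "separable_space (euclidean :: 'a topology)"
  shows "(bounded_ops :: ('a \<Rightarrow>\<^sub>L 'a) set) \<subseteq> closure min_attaining_reducing"
proof
  fix T :: "'a \<Rightarrow>\<^sub>L 'a" assume T: "T \<in> bounded_ops"
  have "\<exists>S\<in>min_attaining_reducing. dist S T < e" if e: "e > 0" for e
  proof -
    \<comment> \<open>Half of \<open>e\<close> turns the weak bound into the strict one that the
      closure requires.\<close>
    obtain G Q :: "'a \<Rightarrow>\<^sub>L 'a" where bG: "in_bicommutant (cadjoint T o\<^sub>L T) G"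
      and near: "norm (T - (T o\<^sub>L G)) \<le> e / 2"
      and gram: "\<And>x y. inner (T (G x)) (T (G y)) = inner (Q x) y"
      and Q: "selfadjoint Q" "finitely_diagonal Q"
      by (rule finitely_diagonal_gram_approximation[OF adjoint_pair_cadjoint[OF T] half_gt_zero[OF e]])
        blast
    have "cadjoint T o\<^sub>L T \<in> bounded_ops"
      using T is_cadjoint_cadjoint[OF T] by (simp add: is_cadjoint_def bounded_ops_def)
    then have "G \<in> bounded_ops" using bG by (rule bounded_ops_in_bicommutant)
    then have "T o\<^sub>L G \<in> bounded_ops" using T by (simp add: bounded_ops_def)
    then have "T o\<^sub>L G \<in> min_attaining_reducing"
      by (rule min_attaining_reducing_if_gram_finitely_diagonal[OF _ Q]) (simp add: gram)
    then show ?thesis using near e by (force simp: dist_norm norm_minus_commute)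
  qed
  then show "T \<in> closure min_attaining_reducing" by (simp add: closure_approachable)
qed

end
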